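(* Let $G$ be a finite group. If $(C,K)$ is a $G$-closed field, then $C$ is a bounded field.
   Context: A pair $(C,K)$, with $C\subseteq K$ a field extension, is a $G$-closed field if (i) $C$ is perfect; (ii) $C\subseteq K$ is Galois with Galois group $G$; (iii) the restriction map $\pi:\mathrm{Gal}(C^{\mathrm{alg}}/C)\to\mathrm{Gal}(K/C)$ is a Frattini cover, i.e. the only closed subgroup $H$ of $\mathrm{Gal}(C^{\mathrm{alg}}/C)$ with $\pi(H)=\mathrm{Gal}(K/C)$ is $\mathrm{Gal}(C^{\mathrm{alg}}/C)$ itself. A field $F$ is bounded if for every natural number $n>0$ there are only finitely many extensions of $F$ of degree $n$ in a fixed algebraic closure $F^{\mathrm{alg}}$. *)

theory Defs
  imports "HOL-Analysis.Function_Topology" "HOL-Algebra.Bij" "HOL-Algebra.Algebraic_Closure"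
begin

text \<open>
  All fields are subfields of one ambient field \<open>L\<close>, which in the end is a fixed algebraic closure
  of the base field \<open>C\<close>. Here \<open>univ_poly L C\<close> is the ring of polynomials over \<open>C\<close>, and the structure
  \<open>L\<lparr>carrier := K\<rparr>\<close> is the subfield \<open>K\<close> viewed as a field of its own.
\<close>

subsection \<open>Perfect fields and Galois extensions\<close>

text \<open>
  Separability of a nonzero polynomial means that its roots are simple in an algebraic closure; it is only
  used when \<open>L\<close> is one.
\<close>

definition separable_poly :: "('a, 'b) ring_scheme \<Rightarrow> 'a list \<Rightarrow> bool"
  where "separable_poly L p \<longleftrightarrow> (\<forall>a \<in> carrier L. ring.alg_mult L p a \<le> 1)"

definition perfect_field :: "('a, 'b) ring_scheme \<Rightarrow> 'a set \<Rightarrow> bool"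
  where "perfect_field L C \<longleftrightarrow>
    (\<forall>p \<in> carrier (univ_poly L C). pirreducible\<^bsub>L\<^esub> C p \<longrightarrow> separable_poly L p)"

definition algebraic_extension :: "('a, 'b) ring_scheme \<Rightarrow> 'a set \<Rightarrow> 'a set \<Rightarrow> bool"
  where "algebraic_extension L C K \<longleftrightarrow> (\<forall>x \<in> K. ring.algebraic L C x)"

definition separable_extension :: "('a, 'b) ring_scheme \<Rightarrow> 'a set \<Rightarrow> 'a set \<Rightarrow> bool"
  where "separable_extension L C K \<longleftrightarrow> (\<forall>x \<in> K. separable_poly L (ring.Irr L C x))"

text \<open>
  The library's \<open>splitted_on K\<close> intersects the multiset of roots with \<open>mset_set K\<close>, which is empty
  for infinite \<open>K\<close>; splitting over \<open>K\<close> is therefore expressed by \<open>splitted\<close> in the field \<open>K\<close>.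
\<close>

definition normal_extension :: "('a, 'b) ring_scheme \<Rightarrow> 'a set \<Rightarrow> 'a set \<Rightarrow> bool"
  where "normal_extension L C K \<longleftrightarrow>
    (\<forall>p \<in> carrier (univ_poly L C).
       pirreducible\<^bsub>L\<^esub> C p \<and> (\<exists>x \<in> K. ring.eval L p x = \<zero>\<^bsub>L\<^esub>)
         \<longrightarrow> ring.splitted (L\<lparr>carrier := K\<rparr>) p)"

definition galois_extension :: "('a, 'b) ring_scheme \<Rightarrow> 'a set \<Rightarrow> 'a set \<Rightarrow> bool"
  where "galois_extension L C K \<longleftrightarrow>
    algebraic_extension L C K \<and> normal_extension L C K \<and> separable_extension L C K"

subsection \<open>Galois groups and the Krull topology\<close>

text \<open>As for \<open>AutoGroup\<close>, automorphisms are extensional functions, composed by \<open>compose K\<close>.\<close>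

definition galois_group :: "('a, 'b) ring_scheme \<Rightarrow> 'a set \<Rightarrow> 'a set \<Rightarrow> ('a \<Rightarrow> 'a) monoid"
  where "galois_group L C K =
    BijGroup K \<lparr>carrier := {\<sigma> \<in> extensional K.
      \<sigma> \<in> ring_iso (L\<lparr>carrier := K\<rparr>) (L\<lparr>carrier := K\<rparr>) \<and> (\<forall>c \<in> C. \<sigma> c = c)}\<rparr>"

text \<open>The open sets are generated by the cosets of \<open>Gal(K/E)\<close>, for \<open>E\<close> finite over \<open>C\<close>.\<close>

definition krull_topology :: "('a, 'b) ring_scheme \<Rightarrow> 'a set \<Rightarrow> 'a set \<Rightarrow> ('a \<Rightarrow> 'a) topology"
  where "krull_topology L C K = topology_generated_by
    {\<sigma> <#\<^bsub>galois_group L C K\<^esub> carrier (galois_group L E K) | \<sigma> E.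
       \<sigma> \<in> carrier (galois_group L C K) \<and>
       subfield E L \<and> C \<subseteq> E \<and> E \<subseteq> K \<and> ring.finite_dimension L C E}"

definition frattini_cover ::
    "'g topology \<Rightarrow> ('g, 'c) monoid_scheme \<Rightarrow> ('h, 'd) monoid_scheme \<Rightarrow> ('g \<Rightarrow> 'h) \<Rightarrow> bool"
  where "frattini_cover T \<Gamma> \<Delta> \<pi> \<longleftrightarrow>
    (\<forall>H. subgroup H \<Gamma> \<and> closedin T H \<and> \<pi> ` H = carrier \<Delta> \<longrightarrow> H = carrier \<Gamma>)"

subsection \<open>G-closed fields and bounded fields\<close>

text \<open>
  A Galois extension \<open>K\<close> of \<open>C\<close> is algebraic, so the algebraic closure \<open>L\<close> of \<open>C\<close> is taken to
  contain it. The isomorphism with \<open>G\<close> is one of abstract groups; for finite \<open>G\<close>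
  the Krull topology on \<open>Gal(K/C)\<close> is discrete, so nothing is lost.
\<close>

locale G_closed_field = algebraic_closure L C + K: subfield K L
  for G :: "('g, 'c) monoid_scheme" and L :: "('a, 'b) ring_scheme" (structure) and C K +
  assumes base_subset: "C \<subseteq> K"
    and base_perfect: "perfect_field L C"
    and galois: "galois_extension L C K"
    and galois_group_iso: "galois_group L C K \<cong> G"
    and restriction_frattini:
      "frattini_cover (krull_topology L C (carrier L))
         (galois_group L C (carrier L)) (galois_group L C K) (\<lambda>\<sigma>. restrict \<sigma> K)"

text \<open>Here \<open>L\<close> is the fixed algebraic closure of \<open>F\<close> in which extensions are counted.\<close>

definition bounded_field :: "('a, 'b) ring_scheme \<Rightarrow> 'a set \<Rightarrow> bool"
  where "bounded_field L F \<longleftrightarrow>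
    (\<forall>n > 0. finite {E. subfield E L \<and> F \<subseteq> E \<and> ring.dimension L n F E})"

end

theory Submission
  imports Defs
begin

text \<open>
  Let \<open>\<Gamma>\<close> be the absolute Galois group of \<open>C\<close>, and attach to an extension \<open>E\<close> of degree \<open>n\<close> the set \<open>S\<close>
  of all conjugates of the elements of a basis: it is \<open>\<Gamma>\<close>-stable and has at most \<open>n\<^sup>2\<close> elements, so it can
  be labelled by numbers below \<open>n\<^sup>2\<close>. Choose one lift to \<open>\<Gamma>\<close> of each element of the finite group
  \<open>Gal(K/C)\<close>, and record the action of these lifts on the labels together with the labels of \<open>S \<inter> E\<close>.
  There are finitely many such records. If \<open>E\<close> and \<open>E'\<close> have the same one, the matching of labels is
  a bijection \<open>\<phi>\<close> between their sets of conjugates, and the elements of \<open>\<Gamma>\<close> that commute with \<open>\<phi>\<close> form a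
  closed subgroup that maps onto \<open>Gal(K/C)\<close>; by the Frattini property it is all of \<open>\<Gamma>\<close>. Hence \<open>E\<close> and
  \<open>E'\<close> have the same pointwise stabilizer, and they are equal because \<open>C\<close> is perfect.
\<close>

subsection \<open>Extension of homomorphisms to the algebraic closure\<close>

text \<open>The homomorphism theorem without a quotient ring: \<open>B\<close> stands for
  \<open>A\<close> modulo the kernel of \<open>f\<close>. The map \<open>h\<close> picks any
  preimage under \<open>f\<close>, and \<open>ker\<close> makes \<open>g\<close> independent of the
  choice.\<close>

lemma ring_hom_factor:
  assumes A: "ring A" and f: "f \<in> ring_hom A B" and surj: "f ` carrier A = carrier B"
    and S: "ring S" and B: "ring B" and g: "g \<in> ring_hom A S"
    and ker: "\<And>a. a \<in> carrier A \<Longrightarrow> f a = \<zero>\<^bsub>B\<^esub> \<Longrightarrow> g a = \<zero>\<^bsub>S\<^esub>"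
  obtains h where "h \<in> ring_hom B S" "\<And>a. a \<in> carrier A \<Longrightarrow> h (f a) = g a"
proof -
  interpret f: ring_hom_ring A B f
    using ring_hom_ringI2[OF A B f] .
  interpret g: ring_hom_ring A S g
    using ring_hom_ringI2[OF A S g] .
  have eq: "g a = g b" if "a \<in> carrier A" "b \<in> carrier A" "f a = f b" for a b
  proof -
    have "f (a \<ominus>\<^bsub>A\<^esub> b) = \<zero>\<^bsub>B\<^esub>"
      using that by (simp add: a_minus_def f.S.r_neg)
    hence "g (a \<ominus>\<^bsub>A\<^esub> b) = \<zero>\<^bsub>S\<^esub>"
      using that by (intro ker) auto
    hence "g a \<ominus>\<^bsub>S\<^esub> g b = \<zero>\<^bsub>S\<^esub>"
      using that by (simp add: a_minus_def)
    thus ?thesis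
      using that by simp
  qed
  define h where "h = (\<lambda>b. g (inv_into (carrier A) f b))"
  have h: "h (f a) = g a" if "a \<in> carrier A" for a
    unfolding h_def using that by (intro eq) (auto simp: inv_into_into f_inv_into_f)
  have "h \<in> ring_hom B S"
  proof (rule ring_hom_memI)
    fix x assume "x \<in> carrier B"
    then obtain a where "a \<in> carrier A" "x = f a" using surj by blast
    thus "h x \<in> carrier S" using h by simp
  next
    fix x y assume "x \<in> carrier B" "y \<in> carrier B"
    then obtain a b where ab: "a \<in> carrier A" "x = f a" "b \<in> carrier A" "y = f b" using surj by blast
    show "h (x \<otimes>\<^bsub>B\<^esub> y) = h x \<otimes>\<^bsub>S\<^esub> h y"
      using ab h[of a] h[of b] h[of "a \<otimes>\<^bsub>A\<^esub> b"] by simp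
    show "h (x \<oplus>\<^bsub>B\<^esub> y) = h x \<oplus>\<^bsub>S\<^esub> h y"
      using ab h[of a] h[of b] h[of "a \<oplus>\<^bsub>A\<^esub> b"] by simp
  next
    show "h \<one>\<^bsub>B\<^esub> = \<one>\<^bsub>S\<^esub>"
      using h[of "\<one>\<^bsub>A\<^esub>"] by simp
  qed
  with h show thesis using that by blast
qed

text \<open>Applying \<open>h\<close> to the coefficients may create leading zeros, so
  \<open>map h\<close> itself is compared with the polynomial operations only up to normalization.
  Evaluation ignores leading zeros, which is why the claim is made for the composite with
  \<open>eval\<close>.\<close>

lemma (in field) eval_map_ring_hom:
  assumes F: "subring F R" and h: "h \<in> ring_hom (R\<lparr>carrier := F\<rparr>) R" and y: "y \<in> carrier R"
  shows "(\<lambda>p. eval (map h p) y) \<in> ring_hom (F[X]) R"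
proof -
  interpret h: ring_hom_ring "R\<lparr>carrier := F\<rparr>" R h
    using ring_hom_ringI2[OF subring_is_ring[OF F] ring_axioms h] .
  have set: "set p \<subseteq> F" if "p \<in> carrier (F[X])" for p
    using that polynomial_incl unfolding univ_poly_carrier[symmetric] by blast
  have map: "set (map h p) \<subseteq> carrier R" if "set p \<subseteq> F" for p
    using that h.hom_closed by auto
  have add: "set (poly_add p q) \<subseteq> F" if "set p \<subseteq> F" "set q \<subseteq> F" for p q
    using poly_add_is_polynomial[OF F that] polynomial_incl by blast
  have mult: "set (poly_mult p q) \<subseteq> F" if "set p \<subseteq> F" "set q \<subseteq> F" for p q
    using poly_mult_is_polynomial[OF F that] polynomial_incl by blast
  show ?thesis
  proof (rule ring_hom_memI)
    fix p assume "p \<in> carrier (F[X])"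
    thus "eval (map h p) y \<in> carrier R"
      using eval_in_carrier[OF map[OF set] y] by simp
  next
    fix p q assume "p \<in> carrier (F[X])" "q \<in> carrier (F[X])"
    hence pq: "set p \<subseteq> F" "set q \<subseteq> F" using set by blast+
    have "eval (map h (poly_mult p q)) y = eval (poly_mult (map h p) (map h q)) y"
      using h.poly_mult_hom'[of p q] pq eval_normalize[OF map[OF mult[OF pq]] y]
      by (simp add: poly_mult_consistent[OF F])
    thus "eval (map h (p \<otimes>\<^bsub>F[X]\<^esub> q)) y = eval (map h p) y \<otimes> eval (map h q) y"
      unfolding univ_poly_mult using eval_poly_mult[OF map map y] pq by simp
    have "eval (map h (poly_add p q)) y = eval (poly_add (map h p) (map h q)) y"
      using h.poly_add_hom'[of p q] pq eval_normalize[OF map[OF add[OF pq]] y]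
      by (simp add: poly_add_consistent[OF F] del: poly_add.simps)
    thus "eval (map h (p \<oplus>\<^bsub>F[X]\<^esub> q)) y = eval (map h p) y \<oplus> eval (map h q) y"
      unfolding univ_poly_add using eval_poly_add[OF map map y] pq by simp
  next
    show "eval (map h \<one>\<^bsub>F[X]\<^esub>) y = \<one>"
      using h.hom_one y by (simp add: univ_poly_one)
  qed
qed

text \<open>Evaluation at \<open>x\<close> maps \<open>F[X]\<close> onto \<open>F(x)\<close>, and
  its kernel consists of multiples of \<open>Irr F x\<close>. Since \<open>y\<close> is a root of
  the image of \<open>Irr F x\<close>, the map sending \<open>p\<close> to
  \<open>eval (map h p) y\<close> kills this kernel and factors through \<open>F(x)\<close>.\<close>

lemma (in field) extend_hom_simple_extension:
  assumes F: "subfield F R" and h: "h \<in> ring_hom (R\<lparr>carrier := F\<rparr>) R"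
    and x: "x \<in> carrier R" "(algebraic over F) x"
    and y: "y \<in> carrier R" "eval (map h (Irr F x)) y = \<zero>"
  obtains g where "g \<in> ring_hom (R\<lparr>carrier := simple_extension F x\<rparr>) R"
    "\<And>a. a \<in> F \<Longrightarrow> g a = h a" "g x = y"
proof -
  note subr = subfieldE(1)[OF F]
  note Irr = IrrE[OF F x]
  interpret P: ring "F[X]" using univ_poly_is_ring[OF subr] .
  interpret e: ring_hom_ring "F[X]" R "\<lambda>p. eval (map h p) y"
    using ring_hom_ringI2[OF P.ring_axioms ring_axioms eval_map_ring_hom[OF subr h y(1)]] .
  interpret h: ring_hom_ring "R\<lparr>carrier := F\<rparr>" R h
    using ring_hom_ringI2[OF subring_is_ring[OF subr] ring_axioms h] .
  have ev: "(\<lambda>p. eval p x) ` carrier (F[X]) = simple_extension F x"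
    using simple_extension_as_eval_img[OF subfieldE(3)[OF F] x(1)] by simp
  have f: "(\<lambda>p. eval p x) \<in> ring_hom (F[X]) (R\<lparr>carrier := simple_extension F x\<rparr>)"
    using eval_is_hom[OF subr x(1)] ev unfolding ring_hom_def by auto
  have ker: "eval (map h p) y = \<zero>" if p: "p \<in> carrier (F[X])" "eval p x = \<zero>" for p
  proof -
    have "Irr F x divides\<^bsub>F[X]\<^esub> p"
      using Irr_minimal[OF F x p] pdivides_iff_shell[OF F Irr(1) p(1)] by simp
    then obtain q where q: "q \<in> carrier (F[X])" "p = Irr F x \<otimes>\<^bsub>F[X]\<^esub> q"
      unfolding factor_def by blast
    thus ?thesis
      using e.hom_mult[OF Irr(1) q(1)] e.hom_closed[OF q(1)] y(2) by simp
  qed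
  obtain g where g: "g \<in> ring_hom (R\<lparr>carrier := simple_extension F x\<rparr>) R"
    and ge: "\<And>p. p \<in> carrier (F[X]) \<Longrightarrow> g (eval p x) = eval (map h p) y"
    by (rule ring_hom_factor[OF P.ring_axioms f _ ring_axioms _ eval_map_ring_hom[OF subr h y(1)]])
       (use ev ker subring_is_ring[OF simple_extension_is_subring[OF subr x(1)]] in auto)
  \<comment> \<open>The constant polynomial with value \<open>a\<close> is \<open>[a]\<close> only
    for nonzero \<open>a\<close>; for zero it is the empty list.\<close>
  have "g a = h a" if "a \<in> F" for a
  proof (cases "a = \<zero>")
    case True
    thus ?thesis using ge[of "[]"] h.hom_zero by (simp add: univ_poly_def polynomial_def)
  next
    case False
    thus ?thesis
      using ge[of "[a]"] that h.hom_closed[of a] subfieldE(3)[OF F] x y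
      by (auto simp add: univ_poly_def polynomial_def)
  qed
  moreover have "g x = y"
    using ge[OF var_closed(1)[OF subr]] eval_var[OF x(1)] h.hom_one h.hom_zero y
    by (simp add: var_def)
  ultimately show thesis using g that by blast
qed

text \<open>The inverse of \<open>k\<close> is already in \<open>K(k)\<close>, which is a field
  because \<open>k\<close> is algebraic over \<open>K\<close>, and which is contained in
  \<open>F\<close>.\<close>

lemma (in algebraic_closure) intermediate_subring_is_subfield:
  assumes F: "subring F L" and incl: "K \<subseteq> F"
  shows "subfield F L"
proof (rule subfieldI'[OF F])
  fix k assume k: "k \<in> F - {\<zero>}"
  hence kL: "k \<in> carrier L" using subringE(1)[OF F] by blast
  have "subfield (simple_extension K k) L"
    using simple_extension_is_subfield[OF subfield_axioms kL] algebraic_extension[OF kL] by simp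
  moreover have "k \<in> simple_extension K k - {\<zero>}"
    using simple_extension_mem[OF subfieldE(1)[OF subfield_axioms] kL] k by simp
  ultimately have "inv k \<in> simple_extension K k"
    using subfield_m_inv(1) by blast
  thus "inv k \<in> F"
    using simple_extension_subring_incl[OF F incl, of k] k by blast
qed

text \<open>A homomorphism of fields keeps the leading coefficient nonzero, so
  \<open>map h p\<close> is a polynomial of the same positive degree. It splits over
  \<open>L\<close> and so has a root there.\<close>

lemma (in algebraic_closure) exists_root_of_image:
  assumes F: "subfield F L" and h: "h \<in> ring_hom (L\<lparr>carrier := F\<rparr>) L"
    and p: "p \<in> carrier (F[X])" "degree p \<ge> 1"
  obtains y where "y \<in> carrier L" "eval (map h p) y = \<zero>"
proof -
  have "p \<in> carrier (poly_ring (L\<lparr>carrier := F\<rparr>))"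
    using p univ_poly_consistent[OF subfieldE(1)[OF F]] by simp
  hence q: "map h p \<in> carrier (poly_ring L)"
    using polynomial_hom[OF h subfield_iff(2)[OF F] field_axioms] by simp
  have "size (roots (map h p)) \<noteq> 0"
    using roots_over_carrier[OF q] p(2) unfolding splitted_def by simp
  then obtain y where "y \<in># roots (map h p)"
    by (metis multiset_nonemptyE size_empty)
  thus thesis
    using roots_mem_iff_is_root[OF q] that unfolding is_root_def by blast
qed

text \<open>
  Zorn's lemma is applied to graphs of partial homomorphisms that are closed under the ring operations;
  the domain of such a graph is automatically a field, since \<open>L\<close> is algebraic over \<open>K\<close>.
\<close>

lemma (in algebraic_closure) extend_hom:
  assumes F: "subring F L" and incl: "K \<subseteq> F" and h: "h \<in> ring_hom (L\<lparr>carrier := F\<rparr>) L"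
  obtains g where "g \<in> ring_hom L L" "\<And>a. a \<in> F \<Longrightarrow> g a = h a"
proof -
  define closed :: "('a \<times> 'a) set \<Rightarrow> bool" where
    "closed M \<longleftrightarrow> (\<forall>(a, b) \<in> M. (\<ominus> a, \<ominus> b) \<in> M \<and>
       (\<forall>(c, d) \<in> M. (a \<oplus> c, b \<oplus> d) \<in> M \<and> (a \<otimes> c, b \<otimes> d) \<in> M))" for M
  define \<G> where "\<G> = {M. M \<subseteq> carrier L \<times> carrier L \<and> (\<lambda>a. (a, h a)) ` F \<subseteq> M \<and>
    single_valued M \<and> closed M}"
  interpret h: ring_hom_ring "L\<lparr>carrier := F\<rparr>" L h
    using ring_hom_ringI2[OF subring_is_ring[OF F] ring_axioms h] .
  \<comment> \<open>This serves twice: with \<open>h\<close> itself it shows that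
    \<open>\<G>\<close> is nonempty, and with a one-step extension it contradicts
    maximality.\<close>
  have graph: "(\<lambda>a. (a, g a)) ` A \<in> \<G>"
    if A: "subring A L" "F \<subseteq> A" and g: "g \<in> ring_hom (L\<lparr>carrier := A\<rparr>) L"
      and gh: "\<And>a. a \<in> F \<Longrightarrow> g a = h a" for g A
  proof -
    interpret g: ring_hom_ring "L\<lparr>carrier := A\<rparr>" L g
      using ring_hom_ringI2[OF subring_is_ring[OF A(1)] ring_axioms g] .
    have "\<ominus> a \<in> A \<and> g (\<ominus> a) = \<ominus> g a" if "a \<in> A" for a
    proof -
      have "\<ominus> a \<in> A" using subringE(5)[OF A(1) that] .
      moreover have "g a \<oplus> g (\<ominus> a) = \<zero>"
        using g.hom_add[of a "\<ominus> a"] that calculation subringE(1)[OF A(1)] g.hom_zero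
        by (simp add: r_neg subset_iff)
      ultimately show ?thesis
        using minus_equality[of "g (\<ominus> a)" "g a"] a_comm g.hom_closed that by auto
    qed
    hence "closed ((\<lambda>a. (a, g a)) ` A)"
      using g.hom_add g.hom_mult subringE(6,7)[OF A(1)] unfolding closed_def by auto
    moreover have "(\<lambda>a. (a, g a)) ` A \<subseteq> carrier L \<times> carrier L"
      using subringE(1)[OF A(1)] g.hom_closed by auto
    moreover have "(\<lambda>a. (a, h a)) ` F \<subseteq> (\<lambda>a. (a, g a)) ` A"
      using A(2) gh by force
    ultimately show ?thesis
      unfolding \<G>_def single_valued_def by auto
  qed
  have "\<exists>M \<in> \<G>. \<forall>N \<in> \<G>. M \<subseteq> N \<longrightarrow> N = M"
  proof (rule subset_Zorn_nonempty)
    show "\<G> \<noteq> {}" using graph[OF F subset_refl h] by blast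
  next
    fix \<C> assume ne: "\<C> \<noteq> {}" and ch: "subset.chain \<G> \<C>"
    have C: "M \<in> \<G>" if "M \<in> \<C>" for M
      using ch that unfolding subset.chain_def by blast
    have common: "\<exists>M \<in> \<C>. u \<in> M \<and> v \<in> M" if "u \<in> \<Union>\<C>" "v \<in> \<Union>\<C>" for u v
    proof -
      from that obtain M N where MN: "M \<in> \<C>" "u \<in> M" "N \<in> \<C>" "v \<in> N" by blast
      hence "M \<subseteq> N \<or> N \<subseteq> M" using ch unfolding subset_chain_def by blast
      thus ?thesis using MN by blast
    qed
    have "single_valued (\<Union>\<C>)"
    proof (rule single_valuedI)
      fix x y z assume "(x, y) \<in> \<Union>\<C>" "(x, z) \<in> \<Union>\<C>"
      then obtain M where "M \<in> \<C>" "(x, y) \<in> M" "(x, z) \<in> M" using common by blast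
      thus "y = z" using C[of M] unfolding \<G>_def by (blast dest: single_valuedD)
    qed
    moreover have "closed (\<Union>\<C>)"
      unfolding closed_def
    proof (clarify, intro conjI ballI)
      fix a b M assume ab: "(a, b) \<in> M" "M \<in> \<C>"
      show "(\<ominus> a, \<ominus> b) \<in> \<Union>\<C>"
        using ab C[of M] unfolding \<G>_def closed_def by blast
      fix u assume "u \<in> \<Union>\<C>"
      then obtain N where "N \<in> \<C>" "(a, b) \<in> N" "u \<in> N" using common[of "(a, b)" u] ab by blast
      thus "case u of (c, d) \<Rightarrow> (a \<oplus> c, b \<oplus> d) \<in> \<Union>\<C> \<and> (a \<otimes> c, b \<otimes> d) \<in> \<Union>\<C>"
        using C[of N] unfolding \<G>_def closed_def by blast
    qed
    moreover have "(\<lambda>a. (a, h a)) ` F \<subseteq> \<Union>\<C>" "\<Union>\<C> \<subseteq> carrier L \<times> carrier L"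
      using ne C unfolding \<G>_def by blast+
    ultimately show "\<Union>\<C> \<in> \<G>" unfolding \<G>_def by blast
  qed
  \<comment> \<open>From here the maximal graph \<open>M\<close> is read back as a homomorphism
    \<open>g\<close> on its domain \<open>A\<close>.\<close>
  then obtain M where M: "M \<in> \<G>" and max: "\<And>N. N \<in> \<G> \<Longrightarrow> M \<subseteq> N \<Longrightarrow> N = M" by blast
  define A where "A = Domain M"
  define g where "g = (\<lambda>a. THE b. (a, b) \<in> M)"
  have g: "g a = b" if "(a, b) \<in> M" for a b
    using that M unfolding g_def \<G>_def by (auto dest: single_valuedD)
  have M_eq: "M = (\<lambda>a. (a, g a)) ` A"
    using g unfolding A_def by force
  have FA: "F \<subseteq> A" and gh: "\<And>a. a \<in> F \<Longrightarrow> g a = h a"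
    using M g unfolding \<G>_def A_def by auto
  have AL: "A \<subseteq> carrier L" and gL: "\<And>a. a \<in> A \<Longrightarrow> g a \<in> carrier L"
    using M unfolding \<G>_def M_eq by auto
  have cl: "\<ominus> a \<in> A" "a \<oplus> b \<in> A" "a \<otimes> b \<in> A" "g (a \<oplus> b) = g a \<oplus> g b" "g (a \<otimes> b) = g a \<otimes> g b"
    if "a \<in> A" "b \<in> A" for a b
  proof -
    have "(a, g a) \<in> M" "(b, g b) \<in> M" using that unfolding M_eq by auto
    hence m: "(\<ominus> a, \<ominus> g a) \<in> M" "(a \<oplus> b, g a \<oplus> g b) \<in> M" "(a \<otimes> b, g a \<otimes> g b) \<in> M"
      using M unfolding \<G>_def closed_def by blast+
    show "\<ominus> a \<in> A" "a \<oplus> b \<in> A" "a \<otimes> b \<in> A"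
      using m unfolding A_def by blast+
    show "g (a \<oplus> b) = g a \<oplus> g b" "g (a \<otimes> b) = g a \<otimes> g b"
      using m g by blast+
  qed
  have A: "subring A L"
    using AL FA cl subringE(3)[OF F] by (intro subringI) auto
  hence Af: "subfield A L"
    using intermediate_subring_is_subfield incl FA by blast
  have g_hom: "g \<in> ring_hom (L\<lparr>carrier := A\<rparr>) L"
    using gL cl gh[OF subringE(3)[OF F]] h.hom_one by (intro ring_hom_memI) auto
  \<comment> \<open>Otherwise some \<open>x\<close> outside \<open>A\<close> could be adjoined, sent
    to a root of the image of its minimal polynomial, and the graph would grow.\<close>
  have "A = carrier L"
  proof (rule ccontr)
    assume "A \<noteq> carrier L"
    then obtain x where x: "x \<in> carrier L" "x \<notin> A" using AL by blast
    have alg: "(algebraic over A) x"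
      using algebraic_mono[OF subset_trans[OF incl FA]] algebraic_extension[OF x(1)] by blast
    obtain y where y: "y \<in> carrier L" "eval (map g (Irr A x)) y = \<zero>"
      using exists_root_of_image[OF Af g_hom IrrE(1)[OF Af x(1) alg]
          pirreducible_degree[OF Af IrrE(1,2)[OF Af x(1) alg]]] by blast
    obtain g' where g': "g' \<in> ring_hom (L\<lparr>carrier := simple_extension A x\<rparr>) L"
      and ga: "\<And>a. a \<in> A \<Longrightarrow> g' a = g a"
      using extend_hom_simple_extension[OF Af g_hom x(1) alg y] by blast
    have sub: "A \<subseteq> simple_extension A x"
      using simple_extension_incl[OF AL x(1)] .
    have "(\<lambda>a. (a, g' a)) ` simple_extension A x \<in> \<G>"
      using simple_extension_is_subring[OF A x(1)] FA sub g' ga gh by (intro graph) auto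
    moreover have "M \<subseteq> (\<lambda>a. (a, g' a)) ` simple_extension A x"
      using sub ga unfolding M_eq by auto
    ultimately have "(\<lambda>a. (a, g' a)) ` simple_extension A x = M" using max by blast
    hence "(x, g' x) \<in> M"
      using simple_extension_mem[OF A x(1)] by blast
    thus False using x(2) unfolding A_def by blast
  qed
  thus thesis using that[of g] g_hom gh by simp
qed

text \<open>Surjectivity comes from finiteness: \<open>g\<close> maps the finite root set of the
  minimal polynomial of \<open>y\<close> over \<open>K\<close> injectively into itself, hence onto
  itself, and \<open>y\<close> is one of these roots.\<close>

lemma (in algebraic_closure) endomorphism_is_bij:
  assumes g: "g \<in> ring_hom L L" and fixes_base: "\<And>a. a \<in> K \<Longrightarrow> g a = a"
  shows "bij_betw g (carrier L) (carrier L)"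
proof -
  interpret g: ring_hom_ring L L g
    using ring_hom_ringI2[OF ring_axioms ring_axioms g] .
  have inj: "inj_on g (carrier L)"
    using non_trivial_field_hom_is_inj[OF g field_axioms field_axioms] .
  have "y \<in> g ` carrier L" if y: "y \<in> carrier L" for y
  proof -
    define p where "p = Irr K y"
    note Irr = IrrE[OF subfield_axioms y algebraic_extension[OF y], folded p_def]
    have p: "p \<in> carrier (poly_ring L)"
      using carrier_polynomial_shell[OF subfieldE(1)[OF subfield_axioms] Irr(1)] .
    have "p \<noteq> []"
      using pirreducible_degree[OF subfield_axioms Irr(1,2)] by auto
    have map_p: "map g p = p"
      using Irr(1) fixes_base polynomial_incl unfolding univ_poly_carrier[symmetric]
      by (metis map_idI subsetD)
    let ?R = "{x. is_root p x}"
    have "finite ?R" using finite_number_of_roots[OF p] .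
    moreover have "eval p (g a) = \<zero>" if "a \<in> carrier L" "eval p a = \<zero>" for a
      using g.eval_hom[OF carrier_is_subring that(1) p] that(2) map_p g.hom_zero by simp
    hence "g ` ?R \<subseteq> ?R"
      using \<open>p \<noteq> []\<close> unfolding is_root_def by auto
    moreover have "inj_on g ?R"
      using inj by (rule inj_on_subset) (auto simp: is_root_def)
    ultimately have "g ` ?R = ?R" by (rule endo_inj_surj)
    moreover have "y \<in> ?R" using Irr(4) y \<open>p \<noteq> []\<close> unfolding is_root_def by simp
    ultimately show ?thesis unfolding is_root_def by blast
  qed
  thus ?thesis using inj g.hom_closed unfolding bij_betw_def by blast
qed

subsection \<open>Galois groups and fixed fields\<close>

lemma galois_group_memD:
  assumes "\<gamma> \<in> carrier (galois_group L C M)"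
  shows "\<gamma> \<in> ring_hom (L\<lparr>carrier := M\<rparr>) (L\<lparr>carrier := M\<rparr>)" "bij_betw \<gamma> M M"
    "\<gamma> \<in> extensional M" "\<And>c. c \<in> C \<Longrightarrow> \<gamma> c = c"
  using assms unfolding galois_group_def ring_iso_def by auto

lemma galois_group_memI:
  assumes "\<gamma> \<in> ring_hom (L\<lparr>carrier := M\<rparr>) (L\<lparr>carrier := M\<rparr>)" "bij_betw \<gamma> M M"
    "\<gamma> \<in> extensional M" "\<And>c. c \<in> C \<Longrightarrow> \<gamma> c = c"
  shows "\<gamma> \<in> carrier (galois_group L C M)"
  using assms unfolding galois_group_def ring_iso_def by auto

text \<open>The extension given by \<open>extend_hom\<close> is bijective by
  \<open>endomorphism_is_bij\<close>; restricting it to \<open>carrier L\<close> makes it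
  extensional, as \<open>galois_group\<close> demands.\<close>

lemma (in algebraic_closure) extend_to_automorphism:
  assumes F: "subring F L" and incl: "K \<subseteq> F" and h: "h \<in> ring_hom (L\<lparr>carrier := F\<rparr>) L"
    and fixes_base: "\<And>a. a \<in> K \<Longrightarrow> h a = a"
  obtains \<gamma> where "\<gamma> \<in> carrier (galois_group L K (carrier L))" "\<And>a. a \<in> F \<Longrightarrow> \<gamma> a = h a"
proof -
  obtain g where g: "g \<in> ring_hom L L" "\<And>a. a \<in> F \<Longrightarrow> g a = h a"
    using extend_hom[OF F incl h] by blast
  have gK: "g a = a" if "a \<in> K" for a
    using g(2) fixes_base that incl by auto
  have "restrict g (carrier L) \<in> carrier (galois_group L K (carrier L))"
    using g(1) gK endomorphism_is_bij[OF g(1) gK] subfieldE(3)[OF subfield_axioms]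
    by (intro galois_group_memI) (auto simp: ring_hom_def subset_iff bij_betw_restrict_eq)
  thus thesis
    using that g subringE(1)[OF F] by (metis restrict_apply subsetD)
qed

text \<open>The half of the Galois correspondence that recovers \<open>E\<close> from its pointwise
  stabilizer. This is where perfectness enters.\<close>

lemma (in algebraic_closure) fixed_field:
  assumes perf: "perfect_field L K" and E: "subfield E L" "K \<subseteq> E" and x: "x \<in> carrier L"
    and fixed: "\<And>\<gamma>. \<gamma> \<in> carrier (galois_group L K (carrier L)) \<Longrightarrow> (\<And>a. a \<in> E \<Longrightarrow> \<gamma> a = a) \<Longrightarrow> \<gamma> x = x"
  shows "x \<in> E"
proof (rule ccontr)
  assume "x \<notin> E"
  have algK: "(algebraic over K) x" using algebraic_extension[OF x] .
  have algE: "(algebraic over E) x" using algebraic_mono[OF E(2) algK] .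
  note sub = subfieldE(1)[OF subfield_axioms] subfieldE(1)[OF E(1)]
  define p q where "p = Irr E x" and "q = Irr K x"
  note p = IrrE[OF E(1) x algE, folded p_def]
  note q = IrrE[OF subfield_axioms x algK, folded q_def]
  have pL: "p \<in> carrier (poly_ring L)" and qL: "q \<in> carrier (poly_ring L)"
    using carrier_polynomial_shell[OF sub(2) p(1)] carrier_polynomial_shell[OF sub(1) q(1)] .
  have qE: "q \<in> carrier (E[X])"
    using q(1) E(2) unfolding univ_poly_carrier[symmetric] polynomial_def by blast
  have "q \<noteq> []"
    using pirreducible_degree[OF subfield_axioms q(1,2)] by auto
  have "p \<noteq> []"
    using pirreducible_degree[OF E(1) p(1,2)] by auto
  \<comment> \<open>Perfectness concerns polynomials over \<open>K\<close>, whereas \<open>p\<close>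
    is over \<open>E\<close>. As \<open>p\<close> divides \<open>q\<close>, simple roots pass from
    \<open>q\<close> to \<open>p\<close>.\<close>
  have "roots p \<subseteq># roots q"
    using pdivides_imp_roots_incl[OF pL qL \<open>q \<noteq> []\<close>] Irr_minimal[OF E(1) x algE qE] q(4)
    unfolding p_def by simp
  hence simple: "count (roots p) a \<le> 1" for a
  proof -
    have "count (roots q) a \<le> 1"
    proof (cases "a \<in> carrier L")
      case True
      thus ?thesis
        using perf q(1,2) alg_mult_eq_count_roots[OF qL]
        unfolding perfect_field_def separable_poly_def by metis
    next
      case False
      thus ?thesis
        using roots_mem_iff_is_root[OF qL] unfolding is_root_def
        by (metis le0 not_in_iff)
    qed
    thus ?thesis using mset_subset_eq_count[OF \<open>roots p \<subseteq># roots q\<close>, of a] by simp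
  qed
  text \<open>The roots of \<open>p\<close> are simple, so \<open>x\<close> has a second conjugate \<open>y\<close> over \<open>E\<close>, to which some \<open>\<gamma>\<close> moves it.\<close>
  have "degree p \<noteq> 1"
  proof
    assume "degree p = 1"
    then obtain a where a: "p = [\<one>, a]"
      using p(3) \<open>p \<noteq> []\<close> by (cases p; cases "tl p") auto
    have "a \<in> E" using p(1) unfolding a univ_poly_carrier[symmetric] polynomial_def by simp
    hence "x = \<ominus> a"
      using p(4) x subfieldE(3)[OF E(1)] unfolding a
      by (auto simp: subset_iff dest: minus_equality[symmetric])
    thus False using subringE(5)[OF sub(2) \<open>a \<in> E\<close>] \<open>x \<notin> E\<close> by simp
  qed
  hence "degree p \<ge> 2"
    using pirreducible_degree[OF E(1) p(1,2)] by simp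
  hence "size (roots p) \<ge> 2"
    using roots_over_carrier[OF pL] unfolding splitted_def by simp
  have "\<exists>y \<in># roots p. y \<noteq> x"
  proof (rule ccontr)
    assume "\<not> ?thesis"
    hence "set_mset (roots p) \<subseteq> {x}" by blast
    hence "roots p = replicate_mset (count (roots p) x) x"
      by (metis set_mset_subset_singletonD size_replicate_mset count_replicate_mset)
    hence "size (roots p) \<le> 1" using simple[of x] by (metis size_replicate_mset)
    thus False using \<open>size (roots p) \<ge> 2\<close> by simp
  qed
  then obtain y where y: "y \<in> carrier L" "eval p y = \<zero>" "y \<noteq> x"
    using roots_mem_iff_is_root[OF pL] unfolding is_root_def by blast
  \<comment> \<open>The inclusion of \<open>E\<close> leaves \<open>p\<close> unchanged, so the root
    \<open>y\<close> of \<open>p\<close> is an admissible image of \<open>x\<close>.\<close>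
  have id: "(\<lambda>a. a) \<in> ring_hom (L\<lparr>carrier := E\<rparr>) L"
    using subfieldE(3)[OF E(1)] by (auto simp: ring_hom_def)
  obtain g where g: "g \<in> ring_hom (L\<lparr>carrier := simple_extension E x\<rparr>) L"
    "\<And>a. a \<in> E \<Longrightarrow> g a = a" "g x = y"
    using extend_hom_simple_extension[OF E(1) id x algE y(1)] y(2) unfolding p_def by auto
  have sub': "E \<subseteq> simple_extension E x"
    using simple_extension_incl[OF subfieldE(3)[OF E(1)] x] .
  obtain \<gamma> where \<gamma>: "\<gamma> \<in> carrier (galois_group L K (carrier L))"
    "\<And>a. a \<in> simple_extension E x \<Longrightarrow> \<gamma> a = g a"
    using extend_to_automorphism[OF simple_extension_is_subring[OF sub(2) x] _ g(1)] sub' E(2) g(2)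
    by (metis subset_iff)
  have "\<gamma> x = x" using \<gamma> g(2) sub' by (intro fixed) auto
  thus False using \<gamma>(2)[OF simple_extension_mem[OF sub(2) x]] g(3) y(3) by simp
qed

section \<open>Group structure of the automorphism groups\<close>

lemma galois_group_mult:
  assumes "\<gamma> \<in> carrier (galois_group L C M)" "\<tau> \<in> carrier (galois_group L C M)"
  shows "\<gamma> \<otimes>\<^bsub>galois_group L C M\<^esub> \<tau> = compose M \<gamma> \<tau>"
  using galois_group_memD(2,3)[OF assms(1)] galois_group_memD(2,3)[OF assms(2)]
  unfolding galois_group_def by (simp add: BijGroup_def Bij_def)

lemma galois_group_one: "\<one>\<^bsub>galois_group L C M\<^esub> = (\<lambda>x \<in> M. x)"
  by (simp add: galois_group_def BijGroup_def)

lemma (in ring) group_galois_group: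
  assumes M: "subring M R" and C: "C \<subseteq> M"
  shows "group (galois_group R C M)"
proof -
  let ?H = "carrier (galois_group R C M)"
  interpret M: ring "R\<lparr>carrier := M\<rparr>" using subring_is_ring[OF M] .
  have Bij: "\<gamma> \<in> Bij M" if "\<gamma> \<in> ?H" for \<gamma>
    using galois_group_memD[OF that] unfolding Bij_def by blast
  interpret B: group "BijGroup M" using group_BijGroup .
  have "subgroup ?H (BijGroup M)"
  proof (rule B.subgroupI)
    show "?H \<subseteq> carrier (BijGroup M)" using Bij by (auto simp: BijGroup_def)
    have "(\<lambda>x \<in> M. x) \<in> ?H"
      using C subringE(3,6,7)[OF M] id_Bij[of M]
      by (intro galois_group_memI) (auto simp: ring_hom_def Bij_def)
    thus "?H \<noteq> {}" by blast
  next
    fix \<gamma> assume s: "\<gamma> \<in> ?H"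
    note \<gamma> = galois_group_memD[OF s]
    have "inv_into M \<gamma> \<in> ring_iso (R\<lparr>carrier := M\<rparr>) (R\<lparr>carrier := M\<rparr>)"
      using ring_iso_set_sym[OF M.ring_axioms, of \<gamma> "R\<lparr>carrier := M\<rparr>"] \<gamma> unfolding ring_iso_def by simp
    moreover have "inv_into M \<gamma> c = c" if "c \<in> C" for c
      using \<gamma>(2,4) that C by (metis bij_betw_imp_inj_on inv_into_f_f subsetD)
    ultimately have "restrict (inv_into M \<gamma>) M \<in> ?H"
      using C subringE(3,6,7)[OF M] unfolding ring_iso_def
      by (intro galois_group_memI) (auto simp: ring_hom_def bij_betw_restrict_eq)
    thus "inv\<^bsub>BijGroup M\<^esub> \<gamma> \<in> ?H" using inv_BijGroup[OF Bij[OF s]] by simp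
  next
    fix \<gamma> \<tau> assume st: "\<gamma> \<in> ?H" "\<tau> \<in> ?H"
    note \<gamma> = galois_group_memD[OF st(1)] and \<tau> = galois_group_memD[OF st(2)]
    have "compose M \<gamma> \<tau> \<in> ?H"
    proof (rule galois_group_memI)
      show "compose M \<gamma> \<tau> \<in> ring_hom (R\<lparr>carrier := M\<rparr>) (R\<lparr>carrier := M\<rparr>)"
        using \<gamma>(1) \<tau>(1) subringE(3,6,7)[OF M] by (auto simp: ring_hom_def compose_def Pi_iff)
      show "bij_betw (compose M \<gamma> \<tau>) M M"
        using bij_betw_compose[OF \<tau>(2) \<gamma>(2)] .
      show "compose M \<gamma> \<tau> \<in> extensional M" by (rule compose_extensional)
      show "compose M \<gamma> \<tau> c = c" if "c \<in> C" for c
        using that C \<gamma>(4) \<tau>(4) by (auto simp: compose_def)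
    qed
    thus "\<gamma> \<otimes>\<^bsub>BijGroup M\<^esub> \<tau> \<in> ?H" using Bij st by (simp add: BijGroup_def)
  qed
  hence "group (BijGroup M\<lparr>carrier := ?H\<rparr>)"
    using B.subgroup_imp_group by blast
  thus ?thesis by (simp add: galois_group_def)
qed

section \<open>Action of the absolute Galois group and restriction to normal extensions\<close>

context algebraic_closure
begin

text \<open>In this locale the base field is called \<open>K\<close>; the Galois extension, called
  \<open>K\<close> in \<open>G_closed_field\<close>, appears below as \<open>M\<close>.\<close>

abbreviation absolute_galois_group :: "('a \<Rightarrow> 'a) monoid" (\<open>\<Gamma>\<close>)
  where "\<Gamma> \<equiv> galois_group L K (carrier L)"

sublocale absolute: group \<Gamma>
  using group_galois_group[OF carrier_is_subring subfieldE(3)[OF subfield_axioms]] .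

lemma absolute_closed: "\<gamma> \<in> carrier \<Gamma> \<Longrightarrow> x \<in> carrier L \<Longrightarrow> \<gamma> x \<in> carrier L"
  using galois_group_memD(2) bij_betw_apply by metis

lemma absolute_mult_apply:
  assumes "\<gamma> \<in> carrier \<Gamma>" "\<tau> \<in> carrier \<Gamma>" "x \<in> carrier L"
  shows "(\<gamma> \<otimes>\<^bsub>\<Gamma>\<^esub> \<tau>) x = \<gamma> (\<tau> x)"
  using assms by (simp add: galois_group_mult compose_def)

lemma absolute_inv_apply:
  assumes "\<gamma> \<in> carrier \<Gamma>" "x \<in> carrier L"
  shows "\<gamma> ((inv\<^bsub>\<Gamma>\<^esub> \<gamma>) x) = x" "(inv\<^bsub>\<Gamma>\<^esub> \<gamma>) (\<gamma> x) = x"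
proof -
  have inv: "inv\<^bsub>\<Gamma>\<^esub> \<gamma> \<in> carrier \<Gamma>" using assms(1) by simp
  have one: "\<one>\<^bsub>\<Gamma>\<^esub> x = x" using assms(2) by (simp add: galois_group_one)
  show "\<gamma> ((inv\<^bsub>\<Gamma>\<^esub> \<gamma>) x) = x"
    using absolute_mult_apply[OF assms(1) inv assms(2)] absolute.r_inv[OF assms(1)] one by simp
  show "(inv\<^bsub>\<Gamma>\<^esub> \<gamma>) (\<gamma> x) = x"
    using absolute_mult_apply[OF inv assms] absolute.l_inv[OF assms(1)] one by simp
qed

lemma absolute_preserves_roots:
  assumes \<gamma>: "\<gamma> \<in> carrier \<Gamma>" and p: "p \<in> carrier (K[X])" and x: "x \<in> carrier L" "eval p x = \<zero>"
  shows "eval p (\<gamma> x) = \<zero>"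
proof -
  interpret s: ring_hom_ring L L \<gamma>
    using ring_hom_ringI2[OF ring_axioms ring_axioms] galois_group_memD(1)[OF \<gamma>] by simp
  have "map \<gamma> p = p"
    using p galois_group_memD(4)[OF \<gamma>] polynomial_incl unfolding univ_poly_carrier[symmetric]
    by (metis map_idI subsetD)
  thus ?thesis
    using s.eval_hom[OF subfieldE(1)[OF subfield_axioms] x(1) p] x(2) s.hom_zero by simp
qed

text \<open>The conjugate \<open>\<gamma> x\<close> is a root of \<open>Irr K x\<close>, which
  splits over \<open>M\<close> by normality. Hence the minimal polynomial of
  \<open>\<gamma> x\<close> over \<open>M\<close>, a divisor of it, is linear.\<close>

lemma absolute_preserves_normal:
  assumes M: "subfield M L" "K \<subseteq> M" "normal_extension L K M"
    and \<gamma>: "\<gamma> \<in> carrier \<Gamma>" and x: "x \<in> M"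
  shows "\<gamma> x \<in> M"
proof -
  have xL: "x \<in> carrier L" using x subfieldE(3)[OF M(1)] by blast
  define y where "y = \<gamma> x"
  have yL: "y \<in> carrier L" using absolute_closed[OF \<gamma> xL] unfolding y_def .
  define p where "p = Irr K x"
  note p = IrrE[OF subfield_axioms xL algebraic_extension[OF xL], folded p_def]
  have alg: "(algebraic over M) y"
    using algebraic_mono[OF M(2) algebraic_extension[OF yL]] .
  define q where "q = Irr M y"
  note q = IrrE[OF M(1) yL alg, folded q_def]
  interpret M: field "L\<lparr>carrier := M\<rparr>" using subfield_iff(2)[OF M(1)] .
  have poly: "univ_poly (L\<lparr>carrier := M\<rparr>) = univ_poly L"
    using univ_poly_consistent[OF subfieldE(1)[OF M(1)]] .
  have pM: "p \<in> carrier (M[X])"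
    using p(1) M(2) unfolding univ_poly_carrier[symmetric] polynomial_def by blast
  have "M.splitted p"
    using M(3) p x unfolding normal_extension_def by blast
  moreover have "eval p y = \<zero>"
    using absolute_preserves_roots[OF \<gamma> p(1) xL p(4)] unfolding y_def .
  hence "q divides\<^bsub>M[X]\<^esub> p"
    using Irr_minimal[OF M(1) yL alg pM] pdivides_iff_shell[OF M(1) q(1) pM] unfolding q_def by simp
  moreover have "p \<noteq> []"
    using pirreducible_degree[OF subfield_axioms p(1,2)] by auto
  ultimately have "degree q = 1"
    using M.splitted_imp_trivial_factors[of p q] pM q(1,2) by (simp add: pdivides_def poly)
  then obtain a where a: "q = [\<one>, a]"
    using q(3) by (cases q; cases "tl q") auto
  have "a \<in> M" using q(1) unfolding a univ_poly_carrier[symmetric] polynomial_def by simp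
  hence "y = \<ominus> a"
    using q(4) yL subfieldE(3)[OF M(1)] unfolding a
    by (auto simp: subset_iff dest: minus_equality[symmetric])
  thus ?thesis using subringE(5)[OF subfieldE(1)[OF M(1)] \<open>a \<in> M\<close>] unfolding y_def by simp
qed

text \<open>Normality makes restriction well defined, and extending automorphisms of
  \<open>M\<close> to \<open>L\<close> makes it surjective.\<close>

lemma restrict_absolute_image:
  assumes M: "subfield M L" "K \<subseteq> M" "normal_extension L K M"
  shows "(\<lambda>\<gamma>. restrict \<gamma> M) ` carrier \<Gamma> = carrier (galois_group L K M)"
proof (intro equalityI subsetI)
  note M_in = subfieldE(3)[OF M(1)]
  fix \<tau> assume "\<tau> \<in> (\<lambda>\<gamma>. restrict \<gamma> M) ` carrier \<Gamma>"
  then obtain \<gamma> where \<gamma>: "\<gamma> \<in> carrier \<Gamma>" and \<tau>: "\<tau> = restrict \<gamma> M" by blast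
  note s = galois_group_memD[OF \<gamma>]
  have cl: "\<gamma> x \<in> M" if "x \<in> M" for x
    using absolute_preserves_normal[OF M \<gamma> that] .
  \<comment> \<open>Stability of \<open>M\<close> under the inverse of \<open>\<gamma>\<close> turns
    the inclusion into equality.\<close>
  have "\<gamma> ` M = M"
  proof (intro equalityI subsetI)
    fix y assume y: "y \<in> M"
    have "(inv\<^bsub>\<Gamma>\<^esub> \<gamma>) y \<in> M"
      using absolute_preserves_normal[OF M absolute.inv_closed[OF \<gamma>] y] .
    thus "y \<in> \<gamma> ` M"
      using absolute_inv_apply(1)[OF \<gamma>, of y] y M_in by (metis image_eqI subsetD)
  qed (use cl in auto)
  hence "bij_betw \<gamma> M M"
    using s(2) M_in unfolding bij_betw_def by (blast intro: inj_on_subset)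
  moreover have "restrict \<gamma> M \<in> ring_hom (L\<lparr>carrier := M\<rparr>) (L\<lparr>carrier := M\<rparr>)"
    using s(1) cl M_in subringE(3,6,7)[OF subfieldE(1)[OF M(1)]]
    by (auto simp: ring_hom_def subset_iff)
  ultimately show "\<tau> \<in> carrier (galois_group L K M)"
    using s(4) M(2) unfolding \<tau> by (intro galois_group_memI) (auto simp: bij_betw_restrict_eq)
next
  note M_in = subfieldE(3)[OF M(1)]
  fix \<tau> assume "\<tau> \<in> carrier (galois_group L K M)"
  note t = galois_group_memD[OF this]
  have "\<tau> \<in> ring_hom (L\<lparr>carrier := M\<rparr>) L"
    using t(1) M_in by (auto simp: ring_hom_def)
  then obtain \<gamma> where \<gamma>: "\<gamma> \<in> carrier \<Gamma>" "\<And>x. x \<in> M \<Longrightarrow> \<gamma> x = \<tau> x"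
    using extend_to_automorphism[OF subfieldE(1)[OF M(1)] M(2) _ t(4)] by blast
  have "\<tau> = restrict \<gamma> M"
    using \<gamma>(2) t(3) by (auto simp: extensional_def)
  thus "\<tau> \<in> (\<lambda>\<gamma>. restrict \<gamma> M) ` carrier \<Gamma>" using \<gamma>(1) by blast
qed

subsection \<open>Closed subgroups of the absolute Galois group\<close>

text \<open>A basic open set of the Krull topology only constrains the values at finitely many elements.\<close>

lemma closedin_krull_topologyI:
  assumes H: "H \<subseteq> carrier \<Gamma>"
    and sep: "\<And>\<gamma>. \<gamma> \<in> carrier \<Gamma> \<Longrightarrow> \<gamma> \<notin> H \<Longrightarrow> \<exists>A. finite A \<and> A \<subseteq> carrier L \<and>
      (\<forall>\<tau> \<in> carrier \<Gamma>. (\<forall>a \<in> A. \<tau> a = \<gamma> a) \<longrightarrow> \<tau> \<notin> H)"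
  shows "closedin (krull_topology L K (carrier L)) H"
proof -
  let ?T = "krull_topology L K (carrier L)"
  define \<B> where "\<B> = {\<gamma> <#\<^bsub>\<Gamma>\<^esub> carrier (galois_group L E (carrier L)) | \<gamma> E.
       \<gamma> \<in> carrier \<Gamma> \<and> subfield E L \<and> K \<subseteq> E \<and> E \<subseteq> carrier L \<and> finite_dimension K E}"
  have T: "?T = topology_generated_by \<B>"
    unfolding krull_topology_def \<B>_def ..
  have sub: "carrier (galois_group L E (carrier L)) \<subseteq> carrier \<Gamma>" if "K \<subseteq> E" for E
  proof
    fix \<gamma> assume "\<gamma> \<in> carrier (galois_group L E (carrier L))"
    note g = galois_group_memD[OF this]
    show "\<gamma> \<in> carrier \<Gamma>"
      using g(4) that by (intro galois_group_memI g(1-3)) blast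
  qed
  have B_sub: "B \<subseteq> carrier \<Gamma>" if "B \<in> \<B>" for B
  proof -
    obtain \<gamma> E where "B = \<gamma> <#\<^bsub>\<Gamma>\<^esub> carrier (galois_group L E (carrier L))" "\<gamma> \<in> carrier \<Gamma>" "K \<subseteq> E"
      using \<open>B \<in> \<B>\<close> unfolding \<B>_def by blast
    thus ?thesis using absolute.l_coset_subset_G[OF sub] by simp
  qed
  \<comment> \<open>Take the field \<open>E\<close> generated by \<open>A\<close> over
    \<open>K\<close>, which is finite over \<open>K\<close>: all elements of the coset of
    \<open>\<gamma>\<close> modulo \<open>Gal(L/E)\<close> agree with \<open>\<gamma>\<close> on
    \<open>A\<close>.\<close>
  have nbhd: "\<exists>B \<in> \<B>. \<gamma> \<in> B \<and> (\<forall>\<tau> \<in> B. \<forall>a \<in> A. \<tau> a = \<gamma> a)"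
    if \<gamma>: "\<gamma> \<in> carrier \<Gamma>" and A: "finite A" "A \<subseteq> carrier L" for \<gamma> A
  proof -
    obtain xs where xs: "set xs = A" using finite_list[OF A(1)] by blast
    define E where "E = finite_extension K xs"
    have xsL: "set xs \<subseteq> carrier L" and alg: "\<And>a. a \<in> set xs \<Longrightarrow> (algebraic over K) a"
      using xs A algebraic_extension by auto
    have E: "subfield E L" "K \<subseteq> E" "finite_dimension K E" "A \<subseteq> E"
      using finite_extension_is_subfield[OF subfield_axioms xsL alg]
        finite_extension_incl[OF subfieldE(3)[OF subfield_axioms] xsL]
        finite_extension_finite_dimension(1)[OF subfield_axioms xsL alg]
        finite_extension_mem[OF subfieldE(1)[OF subfield_axioms] xsL] xs
      unfolding E_def by blast+
    let ?U = "carrier (galois_group L E (carrier L))"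
    have "\<gamma> <#\<^bsub>\<Gamma>\<^esub> ?U \<in> \<B>"
      using \<gamma> E subfieldE(3)[OF E(1)] unfolding \<B>_def by blast
    moreover have "\<one>\<^bsub>\<Gamma>\<^esub> \<in> ?U"
      using group.is_monoid[OF group_galois_group[OF carrier_is_subring subfieldE(3)[OF E(1)]]]
        monoid.one_closed[of "galois_group L E (carrier L)"] by (simp add: galois_group_one)
    hence "\<gamma> \<in> \<gamma> <#\<^bsub>\<Gamma>\<^esub> ?U"
      using \<gamma> absolute.r_one[OF \<gamma>] unfolding l_coset_def by force
    moreover have "\<tau> a = \<gamma> a" if "\<tau> \<in> \<gamma> <#\<^bsub>\<Gamma>\<^esub> ?U" "a \<in> A" for \<tau> a
    proof -
      obtain u where u: "u \<in> ?U" "\<tau> = \<gamma> \<otimes>\<^bsub>\<Gamma>\<^esub> u" using \<open>\<tau> \<in> _\<close> unfolding l_coset_def by blast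
      have "u \<in> carrier \<Gamma>" using sub[OF E(2)] u(1) by blast
      moreover have "u a = a" "a \<in> carrier L"
        using galois_group_memD(4)[OF u(1)] E(4) A(2) \<open>a \<in> A\<close> by blast+
      ultimately show ?thesis
        using absolute_mult_apply[OF \<gamma>] u(2) by simp
    qed
    ultimately show ?thesis by blast
  qed
  \<comment> \<open>With the empty set for \<open>A\<close>, \<open>nbhd\<close> says just that the
    basic sets cover \<open>\<Gamma>\<close>.\<close>
  have top: "topspace ?T = carrier \<Gamma>"
    using nbhd[of _ "{}"] B_sub unfolding T topology_generated_by_topspace by blast
  have "openin ?T (carrier \<Gamma> - H)"
  proof (subst openin_subopen, intro ballI)
    fix \<gamma> assume "\<gamma> \<in> carrier \<Gamma> - H"
    then obtain A where A: "finite A" "A \<subseteq> carrier L"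
      "\<And>\<tau>. \<tau> \<in> carrier \<Gamma> \<Longrightarrow> (\<forall>a \<in> A. \<tau> a = \<gamma> a) \<Longrightarrow> \<tau> \<notin> H" and \<gamma>: "\<gamma> \<in> carrier \<Gamma>"
      using sep[of \<gamma>] by blast
    obtain B where B: "B \<in> \<B>" "\<gamma> \<in> B" "\<forall>\<tau> \<in> B. \<forall>a \<in> A. \<tau> a = \<gamma> a"
      using nbhd[OF \<gamma> A(1,2)] by blast
    have "openin ?T B"
      unfolding T using B(1) by (rule topology_generated_by_Basis)
    moreover have "B \<subseteq> carrier \<Gamma> - H"
      using B A(3) B_sub by blast
    ultimately show "\<exists>B. openin ?T B \<and> \<gamma> \<in> B \<and> B \<subseteq> carrier \<Gamma> - H"
      using B(2) by blast
  qed
  thus ?thesis using H top unfolding closedin_def by simp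
qed

text \<open>Stability of \<open>S\<close> gives closure under products and inverses. The subgroup is
  topologically closed because a failure to commute with \<open>\<phi>\<close> is visible at
  finitely many elements.\<close>

lemma commuting_subgroup_closed:
  assumes \<phi>: "\<phi> ` S \<subseteq> carrier L" and S: "S \<subseteq> carrier L"
    and stable: "\<And>\<gamma> x. \<gamma> \<in> carrier \<Gamma> \<Longrightarrow> x \<in> S \<Longrightarrow> \<gamma> x \<in> S"
  defines "H \<equiv> {\<gamma> \<in> carrier \<Gamma>. \<forall>x \<in> S. \<phi> (\<gamma> x) = \<gamma> (\<phi> x)}"
  shows "subgroup H \<Gamma>" "closedin (krull_topology L K (carrier L)) H"
proof -
  have \<phi>L: "\<phi> x \<in> carrier L" and SL: "x \<in> carrier L" if "x \<in> S" for x
    using that \<phi> S by auto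
  show "subgroup H \<Gamma>"
  proof (rule absolute.subgroupI)
    show "H \<subseteq> carrier \<Gamma>" unfolding H_def by blast
    have "\<one>\<^bsub>\<Gamma>\<^esub> \<in> H"
      using absolute.one_closed \<phi>L SL unfolding H_def by (simp add: galois_group_one)
    thus "H \<noteq> {}" by blast
  next
    fix \<gamma> assume \<gamma>: "\<gamma> \<in> H"
    hence s: "\<gamma> \<in> carrier \<Gamma>" unfolding H_def by blast
    let ?\<tau> = "inv\<^bsub>\<Gamma>\<^esub> \<gamma>"
    have t: "?\<tau> \<in> carrier \<Gamma>" using s by simp
    have "\<phi> (?\<tau> x) = ?\<tau> (\<phi> x)" if x: "x \<in> S" for x
    proof -
      have tx: "?\<tau> x \<in> S" using stable[OF t x] .
      have "?\<tau> (\<phi> x) = ?\<tau> (\<phi> (\<gamma> (?\<tau> x)))"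
        using absolute_inv_apply(1)[OF s SL[OF x]] by simp
      also have "\<dots> = ?\<tau> (\<gamma> (\<phi> (?\<tau> x)))"
        using \<gamma> tx unfolding H_def by simp
      also have "\<dots> = \<phi> (?\<tau> x)"
        using absolute_inv_apply(2)[OF s \<phi>L[OF tx]] .
      finally show ?thesis by simp
    qed
    thus "?\<tau> \<in> H" using t unfolding H_def by blast
  next
    fix \<gamma> \<tau> assume st: "\<gamma> \<in> H" "\<tau> \<in> H"
    thus "\<gamma> \<otimes>\<^bsub>\<Gamma>\<^esub> \<tau> \<in> H"
      using stable SL \<phi>L unfolding H_def by (simp add: absolute_mult_apply)
  qed
  show "closedin (krull_topology L K (carrier L)) H"
  proof (rule closedin_krull_topologyI)
    fix \<gamma> assume "\<gamma> \<in> carrier \<Gamma>" "\<gamma> \<notin> H"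
    then obtain x where x: "x \<in> S" "\<phi> (\<gamma> x) \<noteq> \<gamma> (\<phi> x)" unfolding H_def by blast
    show "\<exists>A. finite A \<and> A \<subseteq> carrier L \<and>
      (\<forall>\<tau> \<in> carrier \<Gamma>. (\<forall>a \<in> A. \<tau> a = \<gamma> a) \<longrightarrow> \<tau> \<notin> H)"
      \<comment> \<open>Any \<open>\<tau>\<close> that agrees with \<open>\<gamma>\<close> at
        \<open>x\<close> and at \<open>\<phi> x\<close> violates the same equation at
        \<open>x\<close>.\<close>
      using x SL \<phi>L unfolding H_def by (intro exI[of _ "{x, \<phi> x}"]) (auto intro!: bexI[of _ x])
  qed (auto simp: H_def)
qed

subsection \<open>Counting extensions of given degree\<close>

text \<open>The powers of \<open>x\<close> with exponent below the degree are linearly independent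
  over \<open>K\<close> and lie in \<open>E\<close>.\<close>

lemma degree_Irr_le_dimension:
  assumes E: "subfield E L" "dimension n K E" and x: "x \<in> E"
  shows "degree (Irr K x) \<le> n"
proof -
  have xL: "x \<in> carrier L" using x subfieldE(3)[OF E(1)] by blast
  have "x [^] i \<in> E" for i :: nat
    using x subringE(3,6)[OF subfieldE(1)[OF E(1)]] by (induct i) auto
  hence "set (exp_base x (degree (Irr K x))) \<subseteq> E"
    unfolding exp_base_def by auto
  thus ?thesis
    using independent_length_le_dimension[OF subfield_axioms E(2)
        exp_base_independent[OF subfield_axioms xL algebraic_extension[OF xL]]]
    by (simp add: exp_base_def)
qed

lemma fixes_Span:
  assumes \<gamma>: "\<gamma> \<in> carrier \<Gamma>" and us: "set us \<subseteq> carrier L"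
    and fixed: "\<And>u. u \<in> set us \<Longrightarrow> \<gamma> u = u" and x: "x \<in> Span K us"
  shows "\<gamma> x = x"
proof -
  interpret g: ring_hom_ring L L \<gamma>
    using ring_hom_ringI2[OF ring_axioms ring_axioms] galois_group_memD(1)[OF \<gamma>] by simp
  have KL: "K \<subseteq> carrier L" using subfieldE(3)[OF subfield_axioms] .
  obtain ks where ks: "set ks \<subseteq> K" "x = combine ks us"
    using x Span_eq_combine_set[OF subfield_axioms us] by blast
  have "\<gamma> (combine ks us) = combine ks us"
    using ks(1) us fixed
  proof (induct ks us rule: combine.induct)
    case (1 k ks u us)
    have "k \<in> carrier L" "u \<in> carrier L" "combine ks us \<in> carrier L"
      using 1(2,3) KL combine_in_carrier[of ks us] by auto
    moreover have "\<gamma> k = k" using galois_group_memD(4)[OF \<gamma>] 1(2) by simp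
    ultimately show ?case using 1 by simp
  qed (auto simp: g.hom_zero)
  thus ?thesis using ks(2) by simp
qed

text \<open>Each of the \<open>n\<close> basis elements has degree at most \<open>n\<close> over
  \<open>K\<close>, hence at most \<open>n\<close> conjugates. An automorphism that fixes
  \<open>S \<inter> E\<close> pointwise fixes the basis, and therefore its span
  \<open>E\<close>.\<close>

lemma finite_stable_generating_set:
  assumes E: "subfield E L" "dimension n K E"
  obtains S where "finite S" "card S \<le> n * n" "S \<subseteq> carrier L"
    "\<And>\<gamma> x. \<gamma> \<in> carrier \<Gamma> \<Longrightarrow> x \<in> S \<Longrightarrow> \<gamma> x \<in> S"
    "\<And>\<gamma> x. \<gamma> \<in> carrier \<Gamma> \<Longrightarrow> (\<And>y. y \<in> S \<inter> E \<Longrightarrow> \<gamma> y = y) \<Longrightarrow> x \<in> E \<Longrightarrow> \<gamma> x = x"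
proof -
  obtain us where us: "set us \<subseteq> carrier L" "length us = n" "Span K us = E"
    using exists_base[OF subfield_axioms E(2)] by blast
  have usE: "set us \<subseteq> E" using Span_base_incl[OF subfield_axioms us(1)] us(3) by simp
  define R where "R = (\<lambda>u. {x. is_root (Irr K u) x})"
  have p: "Irr K u \<in> carrier (K[X])" "Irr K u \<in> carrier (poly_ring L)" "Irr K u \<noteq> []" "eval (Irr K u) u = \<zero>"
    if "u \<in> carrier L" for u
  proof -
    note I = IrrE[OF subfield_axioms that algebraic_extension[OF that]]
    show "Irr K u \<in> carrier (K[X])" "eval (Irr K u) u = \<zero>" using I by simp_all
    show "Irr K u \<in> carrier (poly_ring L)"
      using carrier_polynomial_shell[OF subfieldE(1)[OF subfield_axioms] I(1)] .
    show "Irr K u \<noteq> []" using pirreducible_degree[OF subfield_axioms I(1,2)] by auto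
  qed
  have fin: "finite (R u)" and card: "card (R u) \<le> n" if "u \<in> set us" for u
  proof -
    have u: "u \<in> carrier L" using that us(1) by blast
    have R: "R u = set_mset (roots (Irr K u))"
      using roots_mem_iff_is_root[OF p(2)[OF u]] unfolding R_def by blast
    have "card (set_mset N) \<le> size N" for N :: "'a multiset"
      by (induct N) (auto simp: card_insert_if)
    hence "card (R u) \<le> size (roots (Irr K u))"
      unfolding R .
    also have "\<dots> \<le> degree (Irr K u)" using size_roots_le_degree[OF p(2)[OF u]] .
    also have "\<dots> \<le> n" using degree_Irr_le_dimension[OF E] that usE by blast
    finally show "card (R u) \<le> n" .
    show "finite (R u)" unfolding R by simp
  qed
  define S where "S = (\<Union>u \<in> set us. R u)"
  have "card S \<le> (\<Sum>u \<in> set us. card (R u))"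
    unfolding S_def by (rule card_UN_le) simp
  also have "\<dots> \<le> card (set us) * n"
    using sum_bounded_above[of "set us" "\<lambda>u. card (R u)" n] card by simp
  also have "\<dots> \<le> n * n" using card_length[of us] us(2) by simp
  finally have "card S \<le> n * n" .
  moreover have "finite S" unfolding S_def using fin by blast
  moreover have "S \<subseteq> carrier L" unfolding S_def R_def is_root_def by blast
  moreover have "\<gamma> x \<in> S" if "\<gamma> \<in> carrier \<Gamma>" "x \<in> S" for \<gamma> x
  proof -
    from that(2) obtain u where u: "u \<in> set us" "x \<in> carrier L" "eval (Irr K u) x = \<zero>" "Irr K u \<noteq> []"
      unfolding S_def R_def is_root_def by blast
    hence "eval (Irr K u) (\<gamma> x) = \<zero>"
      using absolute_preserves_roots[OF that(1) p(1)] us(1) by blast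
    thus ?thesis
      using u absolute_closed[OF that(1)] unfolding S_def R_def is_root_def by blast
  qed
  moreover have "\<gamma> x = x" if "\<gamma> \<in> carrier \<Gamma>" "\<And>y. y \<in> S \<inter> E \<Longrightarrow> \<gamma> y = y" "x \<in> E" for \<gamma> x
  proof -
    have "set us \<subseteq> S \<inter> E"
      using us(1) usE p(3,4) unfolding S_def R_def is_root_def by (simp add: subset_iff) blast
    thus ?thesis using fixes_Span[OF that(1) us(1)] that(2,3) us(3) by blast
  qed
  ultimately show thesis using that by blast
qed

text \<open>The record of \<open>E\<close> is the pair \<open>(action E, members E)\<close>; the
  proof shows that it determines \<open>E\<close> and ranges over a finite set.\<close>

lemma finite_frattini_imp_bounded:
  assumes perf: "perfect_field L K" and M: "subfield M L" "K \<subseteq> M" "normal_extension L K M"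
    and fin: "finite (carrier (galois_group L K M))"
    and frattini: "frattini_cover (krull_topology L K (carrier L)) \<Gamma> (galois_group L K M)
      (\<lambda>\<gamma>. restrict \<gamma> M)"
  shows "bounded_field L K"
  unfolding bounded_field_def
proof (intro allI impI)
  fix n :: nat
  let ?\<E> = "{E. subfield E L \<and> K \<subseteq> E \<and> dimension n K E}"
  let ?\<Delta> = "carrier (galois_group L K M)"
  \<comment> \<open>Bundling the requirements into one predicate allows \<open>S\<close> and
    \<open>lab\<close> to be chosen for all \<open>E\<close> at once.\<close>
  define labelled where "labelled = (\<lambda>E (S, lab :: 'a \<Rightarrow> nat).
      S \<subseteq> carrier L \<and> inj_on lab S \<and> lab ` S \<subseteq> {..<n * n} \<and>
      (\<forall>\<gamma> \<in> carrier \<Gamma>. \<forall>x \<in> S. \<gamma> x \<in> S) \<and>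
      (\<forall>\<gamma> \<in> carrier \<Gamma>. (\<forall>y \<in> S \<inter> E. \<gamma> y = y) \<longrightarrow> (\<forall>x \<in> E. \<gamma> x = x)))"
  have "\<exists>S lab. labelled E (S, lab)" if E: "E \<in> ?\<E>" for E
  proof -
    obtain S where S: "finite S" "card S \<le> n * n" "S \<subseteq> carrier L"
      "\<And>\<gamma> x. \<gamma> \<in> carrier \<Gamma> \<Longrightarrow> x \<in> S \<Longrightarrow> \<gamma> x \<in> S"
      "\<And>\<gamma> x. \<gamma> \<in> carrier \<Gamma> \<Longrightarrow> (\<And>y. y \<in> S \<inter> E \<Longrightarrow> \<gamma> y = y) \<Longrightarrow> x \<in> E \<Longrightarrow> \<gamma> x = x"
      using finite_stable_generating_set[of E n] E by blast
    obtain lab :: "'a \<Rightarrow> nat" where lab: "inj_on lab S" "lab ` S \<subseteq> {..<n * n}"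
      using card_le_inj[OF S(1) finite_lessThan, of "n * n"] S(2) by auto
    have "labelled E (S, lab)"
      unfolding labelled_def using S(3-5) lab by simp
    thus ?thesis by blast
  qed
  then obtain S lab where good: "\<And>E. E \<in> ?\<E> \<Longrightarrow> labelled E (S E, lab E)"
    by metis
  have S: "S E \<subseteq> carrier L"
      "\<And>\<gamma> x. \<gamma> \<in> carrier \<Gamma> \<Longrightarrow> x \<in> S E \<Longrightarrow> \<gamma> x \<in> S E"
      "\<And>\<gamma> x. \<gamma> \<in> carrier \<Gamma> \<Longrightarrow> (\<forall>y \<in> S E \<inter> E. \<gamma> y = y) \<Longrightarrow> x \<in> E \<Longrightarrow> \<gamma> x = x"
    and lab: "inj_on (lab E) (S E)" "lab E ` S E \<subseteq> {..<n * n}" if "E \<in> ?\<E>" for E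
    using good[OF that] unfolding labelled_def by simp_all
  \<comment> \<open>The lifts are chosen independently of \<open>E\<close>, so that records of
    different extensions are comparable.\<close>
  have "\<forall>\<delta> \<in> ?\<Delta>. \<exists>\<gamma> \<in> carrier \<Gamma>. restrict \<gamma> M = \<delta>"
    unfolding restrict_absolute_image[OF M, symmetric] by blast
  then obtain lift where lift: "\<And>\<delta>. \<delta> \<in> ?\<Delta> \<Longrightarrow> lift \<delta> \<in> carrier \<Gamma>"
    "\<And>\<delta>. \<delta> \<in> ?\<Delta> \<Longrightarrow> restrict (lift \<delta>) M = \<delta>"
    by metis
  have "?\<Delta> \<noteq> {}"
    unfolding restrict_absolute_image[OF M, symmetric] using absolute.one_closed by blast
  define action where "action = (\<lambda>E. {(\<delta>, lab E x, lab E (lift \<delta> x)) | \<delta> x. \<delta> \<in> ?\<Delta> \<and> x \<in> S E})"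
  have action_mem: "(\<delta>, i, j) \<in> action E \<longleftrightarrow>
      \<delta> \<in> ?\<Delta> \<and> (\<exists>x \<in> S E. i = lab E x \<and> j = lab E (lift \<delta> x))" for \<delta> i j E
    unfolding action_def by auto
  define members where "members = (\<lambda>E. lab E ` (S E \<inter> E))"
  \<comment> \<open>Equality of records is symmetric in \<open>E\<close> and \<open>E'\<close>, so
    one inclusion suffices.\<close>
  have subset: "E \<subseteq> E'" if E: "E \<in> ?\<E>" and E': "E' \<in> ?\<E>" 
      and act: "action E = action E'" and mem: "members E = members E'" for E E'
  proof
    fix z assume z: "z \<in> E"
    define \<phi> where "\<phi> = (\<lambda>x. inv_into (S E') (lab E') (lab E x))"
    \<comment> \<open>The labels in use can be read off the second components of
      \<open>action E\<close>, because \<open>?\<Delta>\<close> is nonempty; equal actions thus use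
      the same labels.\<close>
    have "lab E x \<in> lab E' ` S E'" if "x \<in> S E" for x
    proof -
      obtain \<delta> where "\<delta> \<in> ?\<Delta>" using \<open>?\<Delta> \<noteq> {}\<close> by blast
      hence "(\<delta>, lab E x, lab E (lift \<delta> x)) \<in> action E'"
        unfolding act[symmetric] action_mem using that by auto
      thus ?thesis unfolding action_mem by auto
    qed
    hence \<phi>: "\<phi> x \<in> S E'" "lab E' (\<phi> x) = lab E x" if "x \<in> S E" for x
      using that unfolding \<phi>_def by (auto intro: inv_into_into f_inv_into_f)
    have \<phi>_eqI: "\<phi> x = y" if "x \<in> S E" "y \<in> S E'" "lab E x = lab E' y" for x y
      using \<phi>[OF that(1)] that lab(1)[OF E'] unfolding inj_on_def by metis
    have \<phi>_inj: "x = y" if "x \<in> S E" "y \<in> S E" "\<phi> x = \<phi> y" for x y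
      using \<phi>(2)[OF that(1)] \<phi>(2)[OF that(2)] that lab(1)[OF E] unfolding inj_on_def by metis
    define H where "H = {\<gamma> \<in> carrier \<Gamma>. \<forall>x \<in> S E. \<phi> (\<gamma> x) = \<gamma> (\<phi> x)}"
    have H: "subgroup H \<Gamma>" "closedin (krull_topology L K (carrier L)) H"
      using commuting_subgroup_closed[of \<phi> "S E"] \<phi>(1) S(1)[OF E] S(1)[OF E'] S(2)[OF E]
      unfolding H_def by blast+
    \<comment> \<open>Equal action tables say that \<open>\<phi>\<close>, which preserves labels,
      intertwines the action of each lift on \<open>S E\<close> and on \<open>S E'\<close>.\<close>
    have "lift \<delta> \<in> H" if \<delta>: "\<delta> \<in> ?\<Delta>" for \<delta>
    proof -
      have "\<phi> (lift \<delta> x) = lift \<delta> (\<phi> x)" if x: "x \<in> S E" for x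
      proof -
        have "(\<delta>, lab E x, lab E (lift \<delta> x)) \<in> action E'"
          unfolding act[symmetric] action_mem using \<delta> x by auto
        then obtain x' where x': "x' \<in> S E'" "lab E x = lab E' x'" "lab E (lift \<delta> x) = lab E' (lift \<delta> x')"
          unfolding action_mem by auto
        have "\<phi> x = x'" using \<phi>_eqI[OF x x'(1,2)] .
        moreover have "\<phi> (lift \<delta> x) = lift \<delta> x'"
          using \<phi>_eqI[OF S(2)[OF E lift(1)[OF \<delta>] x] S(2)[OF E' lift(1)[OF \<delta>] x'(1)] x'(3)] .
        ultimately show ?thesis by simp
      qed
      thus ?thesis using lift(1)[OF \<delta>] unfolding H_def by blast
    qed
    hence "?\<Delta> \<subseteq> (\<lambda>\<gamma>. restrict \<gamma> M) ` H"
      using lift(2) by (metis image_eqI subsetI)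
    moreover have "(\<lambda>\<gamma>. restrict \<gamma> M) ` H \<subseteq> ?\<Delta>"
      unfolding restrict_absolute_image[OF M, symmetric] by (intro image_mono subgroup.subset H(1))
    ultimately have "(\<lambda>\<gamma>. restrict \<gamma> M) ` H = ?\<Delta>" by (rule subset_antisym[rotated])
    hence "H = carrier \<Gamma>"
      using frattini H unfolding frattini_cover_def by blast
    hence comm: "\<phi> (\<gamma> x) = \<gamma> (\<phi> x)" if "\<gamma> \<in> carrier \<Gamma>" "x \<in> S E" for \<gamma> x
      using that unfolding H_def by blast
    show "z \<in> E'"
    proof (rule fixed_field[OF perf])
      show "subfield E' L" "K \<subseteq> E'" using E' by auto
      show "z \<in> carrier L" using z E subfieldE(3) by blast
      fix \<gamma> assume \<gamma>: "\<gamma> \<in> carrier \<Gamma>" and fixed: "\<And>a. a \<in> E' \<Longrightarrow> \<gamma> a = a"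
      \<comment> \<open>Equality of \<open>members\<close> puts \<open>\<phi> y\<close> into
        \<open>E'\<close>, where \<open>\<gamma>\<close> is the identity. Then
        \<open>\<phi> (\<gamma> y) = \<phi> y\<close>, and injectivity of \<open>\<phi>\<close>
        gives the claim.\<close>
      have "\<gamma> y = y" if y: "y \<in> S E \<inter> E" for y
      proof -
        have "lab E y \<in> members E" unfolding members_def using y by blast
        hence "lab E y \<in> members E'" unfolding mem .
        then obtain y' where y': "y' \<in> S E'" "y' \<in> E'" "lab E y = lab E' y'"
          unfolding members_def by blast
        have "\<phi> y = y'" using \<phi>_eqI[of y y'] y y' by blast
        hence "\<phi> (\<gamma> y) = \<phi> y" using comm[OF \<gamma>, of y] y fixed[OF y'(2)] by auto
        thus ?thesis using \<phi>_inj[of "\<gamma> y" y] S(2)[OF E \<gamma>, of y] y by blast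
      qed
      thus "\<gamma> z = z" using S(3)[OF E \<gamma> _ z] by blast
    qed
  qed
  have "inj_on (\<lambda>E. (action E, members E)) ?\<E>"
  proof (rule inj_onI)
    fix E E' assume E: "E \<in> ?\<E>" "E' \<in> ?\<E>" and eq: "(action E, members E) = (action E', members E')"
    hence "action E = action E'" "members E = members E'" by simp_all
    thus "E = E'" using subset[OF E] subset[OF E(2,1)] by blast
  qed
  \<comment> \<open>All labels are below \<open>n * n\<close>, a bound common to all
    \<open>E\<close>; this keeps the records in one finite set.\<close>
  moreover have "(\<lambda>E. (action E, members E)) ` ?\<E>
      \<subseteq> Pow (?\<Delta> \<times> {..<n * n} \<times> {..<n * n}) \<times> Pow {..<n * n}"
  proof (rule image_subsetI)
    fix E assume E: "E \<in> ?\<E>"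
    have "lab E x \<in> {..<n * n}" if "x \<in> S E" for x
      using lab(2)[OF E] that by blast
    thus "(action E, members E) \<in> Pow (?\<Delta> \<times> {..<n * n} \<times> {..<n * n}) \<times> Pow {..<n * n}"
      using S(2)[OF E lift(1)] by (auto simp: action_mem members_def)
  qed
  moreover have "finite (Pow (?\<Delta> \<times> {..<n * n} \<times> {..<n * n}) \<times> Pow {..<n * n})"
    using fin by simp
  ultimately show "finite ?\<E>"
    using finite_imageD finite_subset by blast
qed

end

theorem theorem3p22:
  fixes G :: "('g, 'c) monoid_scheme" and L :: "('a, 'b) ring_scheme" and C K :: "'a set"
  assumes "group G" and "finite (carrier G)"
    and "G_closed_field G L C K"
  shows "bounded_field L C"
proof -
  interpret G_closed_field G L C K by fact
  \<comment> \<open>The isomorphism transfers finiteness from \<open>G\<close> to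
    \<open>Gal(K/C)\<close>.\<close>
  obtain f where "bij_betw f (carrier (galois_group L C K)) (carrier G)"
    using galois_group_iso unfolding is_iso_def iso_def by blast
  hence "finite (carrier (galois_group L C K))"
    using assms(2) bij_betw_finite by blast
  thus ?thesis
    using finite_frattini_imp_bounded[OF base_perfect K.subfield_axioms base_subset _ _ restriction_frattini]
      galois unfolding galois_extension_def by blast
qed

end
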